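(* Let $G$ be a graph and $k$ a positive integer. There is a sequence of at most $k$ inclusive vertex splits transforming $G$ into a bipartite graph if and only if there is a set $S\subseteq V(G)$ with $|S|\le k$ such that $G-S$ is bipartite.
   Context: All graphs are finite, simple and undirected. An inclusive vertex split of a vertex $v$ removes $v$ and adds two new vertices $v_1,v_2$ with $N(v_1)\cup N(v_2)=N(v)$ ($N(v_1)$ and $N(v_2)$ may intersect); no other adjacencies change. $G-S$ denotes the subgraph induced by $V(G)\setminus S$. *)

theory Defs
  imports "Graph_Theory.Graph_Theory" "HOL-Library.Infinite_Typeclass"
begin

text \<open>
  Finite simple undirected graphs are represented by \<^locale>\<open>pair_graph\<close>: a finite vertex set
  together with a symmetric irreflexive set of arcs, so that an undirected edge between
  u and v is the pair of arcs (u,v) and (v,u).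
\<close>

definition neighbourhood :: "'a pair_pre_digraph \<Rightarrow> 'a \<Rightarrow> 'a set" where
  "neighbourhood G v = {u. (v, u) \<in> parcs G}"

text \<open>The parts of the bipartition may be empty.\<close>

definition bipartite :: "('a, 'b) pre_digraph \<Rightarrow> bool" where
  "bipartite G \<longleftrightarrow> (\<exists>A B. verts G = A \<union> B \<and> A \<inter> B = {}
     \<and> arcs_ends G \<subseteq> A \<times> B \<union> B \<times> A)"

text \<open>
  H arises from G by one inclusive split, of some vertex v into two new vertices v1 and v2.
  The neighbourhood condition forces all neighbours of v1 and v2 to be vertices of G other
  than v; in particular v1 and v2 are not adjacent. Since H is required to be a graph, hence
  symmetric, its arcs are determined by the neighbourhoods of v1 and v2 and by the last
  conjunct.
\<close>

definition inclusive_split :: "'a pair_pre_digraph \<Rightarrow> 'a pair_pre_digraph \<Rightarrow> bool" where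
  "inclusive_split G H \<longleftrightarrow> pair_graph H \<and>
     (\<exists>v v1 v2. v \<in> pverts G \<and> v1 \<notin> pverts G \<and> v2 \<notin> pverts G \<and> v1 \<noteq> v2
        \<and> pverts H = (pverts G - {v}) \<union> {v1, v2}
        \<and> neighbourhood H v1 \<union> neighbourhood H v2 = neighbourhood G v
        \<and> (\<forall>x \<in> pverts G - {v}. \<forall>y \<in> pverts G - {v}. (x, y) \<in> parcs H \<longleftrightarrow> (x, y) \<in> parcs G))"

end

theory Submission
  imports Defs
begin

text \<open>
  If a split of v yields a graph that becomes bipartite after deleting S, then G becomes
  bipartite after deleting v and the old vertices of S, so each split costs one deletion.
  Conversely, if the graph obtained by deleting S is 2-coloured and v lies in S, split v
  according to the colours of its neighbours: each of the two new vertices sees only one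
  colour and can take the other one, and v need no longer be deleted.
\<close>

text \<open>The set A is one colour class. It need not lie inside W, so a colouring can be passed
  between a graph and its splits without trimming.\<close>

definition bicolours :: "'a set \<Rightarrow> 'a set \<Rightarrow> 'a pair_pre_digraph \<Rightarrow> bool" where
  "bicolours A W G \<longleftrightarrow>
     (\<forall>x y. (x, y) \<in> parcs G \<longrightarrow> x \<in> W \<longrightarrow> y \<in> W \<longrightarrow> (x \<in> A \<longleftrightarrow> y \<notin> A))"

text \<open>This trades the exact partition in \<open>bipartite\<close> for a single untrimmed set:
  given \<open>A\<close>, the two parts are \<open>W \<inter> A\<close> and
  \<open>W - A\<close>.\<close>

lemma bipartite_induced_iff:
  "bipartite (with_proj G \<restriction> W) \<longleftrightarrow> (\<exists>A. bicolours A W G)"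
proof
  assume "bipartite (with_proj G \<restriction> W)"
  then obtain A B where AB: "W = A \<union> B" "A \<inter> B = {}"
    and ends: "arcs_ends (with_proj G \<restriction> W) \<subseteq> A \<times> B \<union> B \<times> A"
    by (auto simp: bipartite_def)
  have "(x, y) \<in> A \<times> B \<union> B \<times> A" if "(x, y) \<in> parcs G" "x \<in> W" "y \<in> W" for x y
    using that ends by (force simp: arcs_ends_def arc_to_ends_def)
  then have "bicolours A W G"
    using AB unfolding bicolours_def by blast
  then show "\<exists>A. bicolours A W G" ..
next
  assume "\<exists>A. bicolours A W G"
  then obtain A where "bicolours A W G" ..
  then have "arcs_ends (with_proj G \<restriction> W) \<subseteq> (W \<inter> A) \<times> (W - A) \<union> (W - A) \<times> (W \<inter> A)"
    by (auto simp: bicolours_def arcs_ends_def arc_to_ends_def)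
  moreover have "verts (with_proj G \<restriction> W) = (W \<inter> A) \<union> (W - A)" "(W \<inter> A) \<inter> (W - A) = {}"
    by auto
  ultimately show "bipartite (with_proj G \<restriction> W)"
    unfolding bipartite_def by blast
qed

lemma bipartite_iff:
  assumes "pair_wf_digraph G"
  shows "bipartite (with_proj G) \<longleftrightarrow> (\<exists>A. bicolours A (pverts G) G)"
proof -
  interpret pair_wf_digraph G by fact
  \<comment> \<open>Well-formedness puts both ends of every arc in \<open>pverts G\<close>, so the
    restriction loses nothing.\<close>
  have "with_proj G \<restriction> pverts G = with_proj G"
    by (auto simp: induce_subgraph_def with_proj_def dest: in_arcsD1 in_arcsD2)
  then show ?thesis
    using bipartite_induced_iff by metis
qed

lemma relpowp_inclusive_split_pair_graph:
  assumes "(inclusive_split ^^ m) G H" and "pair_graph G"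
  shows "pair_graph H"
  using assms by (cases m) (auto simp: inclusive_split_def)

text \<open>Once \<open>v\<close> is deleted too, every remaining vertex of \<open>G\<close>
  survives in \<open>H\<close> with the same arcs, so \<open>A\<close> itself still works.\<close>

lemma inclusive_split_reflects_bicolours:
  assumes "inclusive_split G H" and "finite S" and "S \<subseteq> pverts H"
    and col: "bicolours A (pverts H - S) H"
  shows "\<exists>T \<subseteq> pverts G. finite T \<and> card T \<le> Suc (card S) \<and> bicolours A (pverts G - T) G"
proof -
  obtain v v1 v2 where v: "v \<in> pverts G" "v1 \<notin> pverts G" "v2 \<notin> pverts G"
      "pverts H = (pverts G - {v}) \<union> {v1, v2}"
    and arcs: "\<forall>x \<in> pverts G - {v}. \<forall>y \<in> pverts G - {v}. (x, y) \<in> parcs H \<longleftrightarrow> (x, y) \<in> parcs G"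
    using assms(1) unfolding inclusive_split_def by blast
  \<comment> \<open>\<open>S\<close> may contain \<open>v1\<close> or \<open>v2\<close>, which are
    not vertices of \<open>G\<close>. If it contains neither, \<open>v\<close> is a genuinely
    additional deletion, hence the \<open>Suc\<close> in the bound.\<close>
  let ?T = "insert v (S - {v1, v2})"
  have "card ?T \<le> Suc (card (S - {v1, v2}))"
    using assms(2) by (simp add: card_insert_if)
  also have "\<dots> \<le> Suc (card S)"
    using assms(2) by (simp add: card_mono)
  finally have "card ?T \<le> Suc (card S)" .
  moreover have "?T \<subseteq> pverts G"
    using v assms(3) by auto
  moreover have "pverts G - ?T \<subseteq> pverts H - S"
    using v by auto
  then have "bicolours A (pverts G - ?T) G"
    using col arcs unfolding bicolours_def by blast
  ultimately show ?thesis
    using assms(2) by blast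
qed

text \<open>The colour class stays fixed along the whole sequence; going back from \<open>H\<close>
  to \<open>G\<close>, only the deleted set changes, and its size grows by at most one per
  split.\<close>

lemma relpowp_inclusive_split_reflects_bicolours:
  assumes "(inclusive_split ^^ m) G H" and "bicolours A (pverts H) H"
  shows "\<exists>S \<subseteq> pverts G. finite S \<and> card S \<le> m \<and> bicolours A (pverts G - S) G"
  using assms
proof (induction m arbitrary: G)
  case 0
  then show ?case by (intro exI[of _ "{}"]) auto
next
  case (Suc m)
  from relpowp_Suc_D2[OF Suc.prems(1)] obtain K
    where split: "inclusive_split G K" and "(inclusive_split ^^ m) K H" by blast
  with Suc obtain S where S: "finite S" "S \<subseteq> pverts K" "card S \<le> m" "bicolours A (pverts K - S) K"
    by blast
  from inclusive_split_reflects_bicolours[OF split S(1,2,4)] S(3) show ?case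
    by (meson Suc_le_mono order_trans)
qed

text \<open>The infinite vertex type supplies the two fresh vertices. The other vertices of
  \<open>S\<close> stay in \<open>H\<close>, still to be deleted.\<close>

lemma bicolours_split:
  fixes G :: "'a :: infinite pair_pre_digraph"
  assumes "pair_graph G" and "v \<in> pverts G" and "v \<in> S" and "S \<subseteq> pverts G"
    and col: "bicolours A (pverts G - S) G"
  shows "\<exists>H A'. inclusive_split G H \<and> S - {v} \<subseteq> pverts H \<and> bicolours A' (pverts H - (S - {v})) H"
proof -
  interpret pair_graph G by fact
  have sym: "(y, x) \<in> parcs G" if "(x, y) \<in> parcs G" for x y
    using that pair_sym_arcs by (auto simp: symmetric_def dest: symD)
  have irrefl: "(x, x) \<notin> parcs G" for x
    using pair_no_loops by fastforce
  obtain v1 where v1: "v1 \<notin> pverts G"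
    using ex_new_if_finite[OF infinite_UNIV pair_finite_verts] by blast
  obtain v2 where v2: "v2 \<notin> insert v1 (pverts G)"
    using ex_new_if_finite[OF infinite_UNIV, of "insert v1 (pverts G)"] pair_finite_verts by blast
  \<comment> \<open>Neighbours of \<open>v\<close> inside \<open>S\<close> are sorted by
    \<open>A\<close> as well, although \<open>col\<close> says nothing about them: the new vertices
    must together inherit all of \<open>neighbourhood G v\<close>.\<close>
  define N1 N2 where "N1 = neighbourhood G v \<inter> A" and "N2 = neighbourhood G v - A"
  have N: "N1 \<subseteq> pverts G - {v}" "N2 \<subseteq> pverts G - {v}"
    using irrefl by (auto simp: N1_def N2_def neighbourhood_def dest: in_arcsD2)
  define H where "H = \<lparr>pverts = insert v1 (insert v2 (pverts G - {v})),
    parcs = {(x, y). (x, y) \<in> parcs G \<and> x \<noteq> v \<and> y \<noteq> v}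
      \<union> {v1} \<times> N1 \<union> N1 \<times> {v1} \<union> {v2} \<times> N2 \<union> N2 \<times> {v2}\<rparr>"
  have arc_iff: "(x, y) \<in> parcs H \<longleftrightarrow> (x, y) \<in> parcs G \<and> x \<noteq> v \<and> y \<noteq> v
      \<or> x = v1 \<and> y \<in> N1 \<or> x \<in> N1 \<and> y = v1 \<or> x = v2 \<and> y \<in> N2 \<or> x \<in> N2 \<and> y = v2" for x y
    by (auto simp: H_def)
  have verts_H: "pverts H = insert v1 (insert v2 (pverts G - {v}))"
    by (simp add: H_def)
  have in_G: "x \<in> pverts G \<and> y \<in> pverts G" if "(x, y) \<in> parcs G" for x y
    using that in_arcsD1 in_arcsD2 by blast
  \<comment> \<open>This collects what \<open>pair_graph H\<close> requires besides finiteness: ends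
    in the vertex set, no loops, symmetry.\<close>
  have wf: "x \<in> pverts H \<and> y \<in> pverts H \<and> x \<noteq> y \<and> (y, x) \<in> parcs H" if "(x, y) \<in> parcs H" for x y
    using that N v1 v2 in_G irrefl sym unfolding arc_iff verts_H by blast
  have fin: "finite (pverts H)"
    using pair_finite_verts by (simp add: verts_H)
  have "parcs H \<subseteq> pverts H \<times> pverts H"
    using wf by auto
  then have fin_arcs: "finite (parcs H)"
    using fin finite_subset by blast
  have H: "pair_graph H"
  proof
    show "symmetric H"
      using wf by (auto simp: symmetric_def arcs_ends_def arc_to_ends_def intro!: symI)
  qed (use wf fin fin_arcs in auto)
  have "neighbourhood H v1 = N1" "neighbourhood H v2 = N2"
    using N v1 v2 in_G unfolding neighbourhood_def arc_iff by blast+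
  then have "neighbourhood H v1 \<union> neighbourhood H v2 = neighbourhood G v"
    by (auto simp: N1_def N2_def)
  moreover have "(x, y) \<in> parcs H \<longleftrightarrow> (x, y) \<in> parcs G"
    if "x \<in> pverts G - {v}" "y \<in> pverts G - {v}" for x y
    using that v1 v2 unfolding arc_iff by blast
  moreover have "pverts H = (pverts G - {v}) \<union> {v1, v2}"
    by (auto simp: verts_H)
  ultimately have "inclusive_split G H"
    using H v1 v2 assms(2) unfolding inclusive_split_def by blast
  moreover have "S - {v} \<subseteq> pverts H"
    using assms(4) by (auto simp: verts_H)
  \<comment> \<open>All neighbours of \<open>v1\<close> lie in \<open>A\<close> and none of
    \<open>v2\<close> do, so \<open>v1\<close> must be outside the class and \<open>v2\<close>
    inside. Removing \<open>v1\<close> matters because \<open>A\<close> may contain vertices foreign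
    to \<open>G\<close>.\<close>
  moreover have "bicolours (insert v2 (A - {v1})) (pverts H - (S - {v})) H"
    unfolding bicolours_def
  proof (intro allI impI)
    fix x y
    assume xy: "(x, y) \<in> parcs H" "x \<in> pverts H - (S - {v})" "y \<in> pverts H - (S - {v})"
    from xy(1) consider "(x, y) \<in> parcs G" "x \<noteq> v" "y \<noteq> v"
      | "x = v1" "y \<in> N1" | "x \<in> N1" "y = v1" | "x = v2" "y \<in> N2" | "x \<in> N2" "y = v2"
      unfolding arc_iff by blast
    then show "x \<in> insert v2 (A - {v1}) \<longleftrightarrow> y \<notin> insert v2 (A - {v1})"
    proof cases
      case 1
      \<comment> \<open>An end of this arc is not \<open>v\<close> and not in
        \<open>S - {v}\<close>, hence not in \<open>S\<close>.\<close>
      then have "x \<in> pverts G - S" "y \<in> pverts G - S"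
        using xy in_G by blast+
      then show ?thesis
        using 1 col v1 v2 unfolding bicolours_def by blast
    qed (use N v1 v2 in \<open>auto simp: N1_def N2_def\<close>)
  qed
  ultimately show ?thesis by blast
qed

text \<open>Each split takes one vertex out of the set to be deleted. The graph and the colour class
  both change, so the induction generalises over them.\<close>

lemma ex_relpowp_inclusive_split_bicolours:
  fixes G :: "'a :: infinite pair_pre_digraph"
  assumes "pair_graph G" and "finite S" and "S \<subseteq> pverts G" and "bicolours A (pverts G - S) G"
  shows "\<exists>H A'. (inclusive_split ^^ card S) G H \<and> bicolours A' (pverts H) H"
  using assms
proof (induction "card S" arbitrary: S G A)
  case 0
  then show ?case by auto
next
  case (Suc n)
  then obtain v where v: "v \<in> S" by fastforce
  with Suc.prems bicolours_split[of G v S A] obtain K B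
    where K: "inclusive_split G K" "S - {v} \<subseteq> pverts K" "bicolours B (pverts K - (S - {v})) K"
    by blast
  have n: "n = card (S - {v})"
    using Suc.hyps(2) Suc.prems(2) v by simp
  have "pair_graph K"
    using K(1) by (simp add: inclusive_split_def)
  with Suc.hyps(1)[OF n] K Suc.prems(2) obtain H A'
    where "(inclusive_split ^^ n) K H" "bicolours A' (pverts H) H"
    unfolding n by blast
  with K(1) show ?case
    unfolding Suc.hyps(2)[symmetric] by (blast intro: relpowp_Suc_I2)
qed

theorem theorem8:
  fixes G :: "'a :: infinite pair_pre_digraph" and k :: nat
  assumes "pair_graph G" and "k > 0"
  shows "(\<exists>m \<le> k. \<exists>H. (inclusive_split ^^ m) G H \<and> bipartite (with_proj H)) \<longleftrightarrow>
         (\<exists>S \<subseteq> pverts G. card S \<le> k \<and> bipartite (with_proj G \<restriction> (pverts G - S)))"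
proof -
  interpret pair_graph G by fact
  \<comment> \<open>\<open>bipartite_iff\<close> needs a well-formed graph, which every graph
    reached by splits from \<open>G\<close> is.\<close>
  have bip: "bipartite (with_proj H) \<longleftrightarrow> (\<exists>A. bicolours A (pverts H) H)"
    if "(inclusive_split ^^ m) G H" for m H
  proof -
    interpret H: pair_graph H
      using relpowp_inclusive_split_pair_graph[OF that assms(1)] .
    show ?thesis
      using bipartite_iff H.pair_wf_digraph by blast
  qed
  show ?thesis
    unfolding bipartite_induced_iff
  proof
    assume "\<exists>m \<le> k. \<exists>H. (inclusive_split ^^ m) G H \<and> bipartite (with_proj H)"
    then obtain m H A where "m \<le> k" "(inclusive_split ^^ m) G H" "bicolours A (pverts H) H"
      using bip by blast
    then show "\<exists>S \<subseteq> pverts G. card S \<le> k \<and> (\<exists>A. bicolours A (pverts G - S) G)"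
      using relpowp_inclusive_split_reflects_bicolours order_trans by metis
  next
    assume "\<exists>S \<subseteq> pverts G. card S \<le> k \<and> (\<exists>A. bicolours A (pverts G - S) G)"
    then obtain S A where S: "S \<subseteq> pverts G" "card S \<le> k" "bicolours A (pverts G - S) G"
      by blast
    then have "finite S"
      using pair_finite_verts finite_subset by blast
    \<comment> \<open>The number of splits is \<open>m = card S\<close>.\<close>
    with S assms(1) show "\<exists>m \<le> k. \<exists>H. (inclusive_split ^^ m) G H \<and> bipartite (with_proj H)"
      using ex_relpowp_inclusive_split_bicolours bip by metis
  qed
qed

end
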